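(* Let $k>0$. For $\lambda,\rho,v\in\mathbb{C}$ with $\Re\left(\frac{v}{k}\right)>-1$, $\Re(\lambda+\rho)>0$, $\Re\left(\lambda+\frac{v}{k}\right)>0$ and $z>0$ (where $z$ is the variable of integration), the following holds, $y$ being a parameter: $$\int_{0}^{1}z^{\lambda-1}(1-z)^{2(\lambda+\rho)-1}\left(1-\frac{z}{3}\right)^{2\lambda-1}\left(1-\frac{z}{4}\right)^{(\lambda+\rho)-1}J_{v}^{k}\left(\frac{yz\left(1-\frac{z}{3}\right)^2}{2}\right)dz$$ $$=\frac{\left(\frac{y}{2}\right)^{v/k}\,\Gamma(\lambda+\rho)\left(\frac{2}{3}\right)^{2(\lambda+\frac{v}{k})}}{k^{v/k}}\;{}_1\Psi_{2}\left[\begin{array}{c}\left(\lambda+\frac{v}{k},2\right)\\ \left(\frac{v}{k}+1,1\right),\ \left(2\lambda+\frac{v}{k}+\rho,2\right)\end{array};\ -\frac{4y^2}{81k}\right].$$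
   Context: The $k$-gamma function is $\Gamma_k(s)=\int_0^\infty t^{s-1}e^{-t^k/k}\,dt$, and satisfies $\Gamma_k(s)=k^{\frac{s}{k}-1}\Gamma(s/k)$, where $\Gamma$ is the gamma function. The classical $k$-Bessel function is given, for $k>0$, by $$J_{v}^{k}(x)=\sum_{n=0}^{\infty}\frac{(-1)^n}{\Gamma_k(v+nk+k)\,n!}\left(\frac{x}{2}\right)^{\frac{v}{k}+2n}.$$ The Wright-type hypergeometric function is $${}_1\Psi_2\left[\begin{array}{c}(\alpha_1,A_1)\\(\beta_1,B_1),(\beta_2,B_2)\end{array};x\right]=\sum_{n=0}^\infty\frac{\Gamma(\alpha_1+A_1n)}{\Gamma(\beta_1+B_1n)\Gamma(\beta_2+B_2n)}\frac{x^n}{n!}.$$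
   Formalization: The printed identity is off by a factor 2 (e.g. it fails for k=1, v=0, λ=1, ρ=0); the formal version takes the argument of J_v^k to be yz(1-z/3)^2 rather than yz(1-z/3)^2/2, with the right-hand side as printed. *)

theory Defs
  imports "HOL-Analysis.Analysis"
begin

text \<open>
  Principal-branch power, except that \<open>0\<close> to the exponent \<open>0\<close> is \<open>1\<close>, as the series for
  \<open>J\<close> requires at \<open>x = 0\<close>, \<open>v = 0\<close> (\<^const>\<open>powr\<close> gives \<open>0\<close> there).  If \<open>w = 0\<close> and
  \<open>a \<noteq> 0\<close> the value is \<open>0\<close>.
\<close>
definition cpow :: "complex \<Rightarrow> complex \<Rightarrow> complex" where
  "cpow w a = (if a = 0 then 1 else w powr a)"

definition k_Gamma :: "real \<Rightarrow> complex \<Rightarrow> complex" where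
  "k_Gamma k s =
     integral {0<..} (\<lambda>t::real. of_real t powr (s - 1) * of_real (exp (- (t powr k / k))))"

definition k_Bessel_J :: "real \<Rightarrow> complex \<Rightarrow> complex \<Rightarrow> complex" where
  "k_Bessel_J k v x =
     (\<Sum>n. (-1) ^ n / (k_Gamma k (v + of_nat n * of_real k + of_real k) * fact n)
          * cpow (x / 2) (v / of_real k + 2 * of_nat n))"

definition Wright_Psi_1_2 ::
  "complex \<times> real \<Rightarrow> complex \<times> real \<Rightarrow> complex \<times> real \<Rightarrow> complex \<Rightarrow> complex" where
  "Wright_Psi_1_2 = (\<lambda>(\<alpha>\<^sub>1, A\<^sub>1) (\<beta>\<^sub>1, B\<^sub>1) (\<beta>\<^sub>2, B\<^sub>2) x.
     \<Sum>n. Gamma (\<alpha>\<^sub>1 + of_real A\<^sub>1 * of_nat n)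
          / (Gamma (\<beta>\<^sub>1 + of_real B\<^sub>1 * of_nat n) * Gamma (\<beta>\<^sub>2 + of_real B\<^sub>2 * of_nat n))
          * (x ^ n / fact n))"

end

theory Submission
  imports Defs
begin

text \<open>
  The substitution \<open>u = 9/4 * x * (1 - x/3)\<^sup>2\<close> maps \<open>(0,1)\<close> increasingly onto itself, with
  \<open>1 - u = (1 - x)\<^sup>2 * (1 - x/4)\<close> and \<open>du = 9/4 * (1 - x) * (1 - x/3) dx\<close>.  It turns the weight of
  the theorem into the integrand of Euler's Beta integral.  As the argument of the Bessel function
  is a multiple of \<open>z * (1 - z/3)\<^sup>2\<close>, each term of the Bessel series only shifts the Beta parameter
  \<open>lam + v/k\<close> by \<open>2n\<close>.  Since \<open>0 < z * (1 - z/3)\<^sup>2 < 1\<close>, all terms are dominated by the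
  zeroth one times a summable sequence, so summation and integration commute.
\<close>

section \<open>The k-Gamma function and the k-Bessel series\<close>

text \<open>The substitution \<open>u = t powr k / k\<close>, with
  \<open>du = t powr (k - 1) dt\<close>, turns the defining integral into Euler's integral for
  \<open>Gamma\<close> at \<open>s / k\<close>.\<close>

lemma k_Gamma_eq:
  assumes k: "k > 0" and s: "Re s > 0"
  shows "k_Gamma k s = of_real k powr (s / of_real k - 1) * Gamma (s / of_real k)"
proof -
  define w where "w = s / of_real k"
  have w: "Re w > 0" using assms by (simp add: w_def)
  define f where "f = (\<lambda>u::real. of_real u powr (w - 1) / of_real (exp u) :: complex)"
  define g where "g = (\<lambda>t::real. t powr k / k)"
  have der: "(g has_field_derivative t powr (k - 1)) (at t within {0<..})" if "t \<in> {0<..}" for t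
    unfolding g_def using that k by (auto intro!: derivative_eq_intros)
  have inj: "inj_on g {0<..}"
  proof (rule inj_onI)
    fix x y assume "x \<in> {0<..}" "y \<in> {0<..}" "g x = g y"
    then have "(x powr k) powr (1/k) = (y powr k) powr (1/k)" using k by (simp add: g_def)
    then show "x = y" using k \<open>x \<in> _\<close> \<open>y \<in> _\<close> by (simp add: powr_powr)
  qed
  have img: "g ` {0<..} = {0<..}"
  proof (intro equalityI subsetI)
    fix u assume "u \<in> g ` {0<..}" then show "u \<in> {0<..}" using k by (auto simp: g_def)
  next
    fix u :: real assume u: "u \<in> {0<..}"
    then have "u = g ((k * u) powr (1/k))" using k by (simp add: g_def powr_powr)
    moreover have "(k * u) powr (1/k) \<in> {0<..}" using u k by simp
    ultimately show "u \<in> g ` {0<..}" by blast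
  qed
  \<comment> \<open>The change of variables theorem transfers absolute integrability and the value
    together, hence the conjunction.\<close>
  have "f absolutely_integrable_on g ` {0<..} \<and> integral (g ` {0<..}) f = Gamma w"
    unfolding img f_def using w
    by (intro conjI absolutely_integrable_Gamma_integral' integral_unique Gamma_integral_complex')
  then have I: "integral {0<..} (\<lambda>t. \<bar>t powr (k - 1)\<bar> *\<^sub>R f (g t)) = Gamma w"
    using has_absolute_integral_change_of_variables_real[of "{0<..}", OF _ der inj, of f "Gamma w"]
    by simp
  have "k_Gamma k s = integral {0<..} (\<lambda>t. of_real k powr (w - 1) * (\<bar>t powr (k - 1)\<bar> *\<^sub>R f (g t)))"
    unfolding k_Gamma_def
  proof (rule integral_cong)
    fix t :: real assume "t \<in> {0<..}"
    then have t: "t > 0" by simp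
    \<comment> \<open>All bases are positive reals, so each principal power is \<open>exp\<close> of
      the exponent times a real logarithm; the identity reduces to comparing expressions linear in
      \<open>L\<close> and \<open>K\<close>.\<close>
    define L where "L = complex_of_real (ln t)"
    define K where "K = complex_of_real (ln k)"
    have sw: "s = w * of_real k" using k by (simp add: w_def)
    have 1: "of_real t powr (s - 1) = exp ((s - 1) * L)"
      using t by (simp add: powr_def L_def Ln_of_real)
    have 2: "of_real k powr (w - 1) = exp ((w - 1) * K)"
      using k by (simp add: powr_def K_def Ln_of_real)
    have 3: "of_real (t powr (k - 1)) = exp ((of_real k - 1) * L)"
      using t by (simp add: powr_def L_def exp_of_real[symmetric])
    have 4: "of_real (g t) powr (w - 1) = exp ((w - 1) * (of_real k * L - K))"
    proof -
      have "ln (g t) = k * ln t - ln k" using t k by (simp add: g_def ln_div ln_powr)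
      moreover have "g t > 0" using t k by (simp add: g_def)
      ultimately show ?thesis by (simp add: powr_def Ln_of_real L_def K_def)
    qed
    have "of_real k powr (w - 1) * (\<bar>t powr (k - 1)\<bar> *\<^sub>R f (g t))
        = exp ((w - 1) * K) * exp ((of_real k - 1) * L) * exp ((w - 1) * (of_real k * L - K))
            / of_real (exp (g t))"
      using 2 3 4 by (simp add: f_def scaleR_conv_of_real)
    also have "\<dots> = exp ((s - 1) * L) / of_real (exp (g t))"
      unfolding exp_add[symmetric] sw by (simp add: algebra_simps)
    also have "\<dots> = of_real t powr (s - 1) * of_real (exp (- (t powr k / k)))"
      unfolding 1 by (simp add: g_def exp_minus field_simps)
    finally show "of_real t powr (s - 1) * of_real (exp (- (t powr k / k)))
        = of_real k powr (w - 1) * (\<bar>t powr (k - 1)\<bar> *\<^sub>R f (g t))" ..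
  qed
  also have "\<dots> = of_real k powr (w - 1) * Gamma w"
    by (simp only: integral_mult_right I)
  finally show ?thesis by (simp add: w_def)
qed

text \<open>Splits off the part of the exponent that depends on \<open>n\<close>, which gives the
  terms of the Bessel series a common prefactor. The bound on \<open>Re a\<close> keeps the exponent
  on the left away from 0 for \<open>n > 0\<close>, so the special value of \<open>cpow\<close>
  enters there only for \<open>n = 0\<close>.\<close>

lemma cpow_add_even:
  assumes "Re a > -1"
  shows "cpow z (a + 2 * of_nat n) = cpow z a * z ^ (2 * n)"
proof (cases "n = 0")
  case False
  then have "Re (a + 2 * of_nat n) > 0" using assms by simp
  then have ne: "a + 2 * of_nat n \<noteq> 0" by (metis zero_complex.sel(1) less_irrefl)
  have "z powr (2 * of_nat n) = z ^ (2 * n)" if "z \<noteq> 0"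
    using powr_nat[of z "2 * n"] that by simp
  then show ?thesis
    using ne False by (cases "z = 0") (auto simp: cpow_def powr_add)
qed simp

text \<open>A positive real factor leaves the argument unchanged, so \<open>Ln\<close> is additive
  without a branch correction.\<close>

lemma cpow_mult_of_real:
  assumes "r > 0"
  shows "cpow (z * of_real r) a = cpow z a * of_real r powr a"
proof (cases "z = 0")
  case False
  then have "Ln (z * of_real r) = of_real (ln r) + Ln z"
    using Ln_times_of_real[OF assms False] assms by (simp add: mult.commute Ln_of_real)
  then show ?thesis
    using False assms by (simp add: cpow_def powr_def exp_add[symmetric] Ln_of_real algebra_simps)
qed (use assms in \<open>auto simp: cpow_def\<close>)

text \<open>Ratio test: by \<open>rGamma z = z * rGamma (z + 1)\<close>, the norm of
  \<open>rGamma (w + of_nat n)\<close> does not increase with \<open>n\<close> once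
  \<open>norm (w + of_nat n) \<ge> 1\<close>, and the factorial supplies the factor
  \<open>norm x / Suc n\<close>.\<close>

lemma summable_norm_rGamma_series:
  fixes x w :: complex
  shows "summable (\<lambda>n. norm (x ^ n * rGamma (w + of_nat n) / fact n))"
proof -
  \<comment> \<open>\<open>n \<ge> 2 * norm x\<close> makes the ratio at most \<open>1/2\<close>,
    and \<open>n \<ge> norm w + 1\<close> gives \<open>norm (w + of_nat n) \<ge> 1\<close>.\<close>
  define N where "N = nat \<lceil>max (2 * norm x) (norm w + 1)\<rceil>"
  show ?thesis
  proof (rule summable_ratio_test[where c = "1/2" and N = N])
    fix n assume n: "n \<ge> N"
    have n1: "2 * norm x \<le> real n" "norm w + 1 \<le> real n" using n unfolding N_def by linarith+
    have "norm (of_nat n :: complex) \<le> norm (w + of_nat n) + norm w"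
      using norm_triangle_ineq4[of "w + of_nat n" w] by simp
    then have 1: "1 \<le> norm (w + of_nat n)" using n1(2) by simp
    have "norm (rGamma (w + of_nat n)) = norm (w + of_nat n) * norm (rGamma (w + of_nat (Suc n)))"
      using rGamma_plus1[of "w + of_nat n"] by (simp add: norm_mult[symmetric] add_ac)
    then have 2: "norm (rGamma (w + of_nat (Suc n))) \<le> norm (rGamma (w + of_nat n))"
      using mult_right_mono[OF 1, of "norm (rGamma (w + of_nat (Suc n)))"] by simp
    have 3: "norm x / real (Suc n) \<le> 1/2" using n1(1) by (simp add: field_simps)
    have "norm (x ^ Suc n * rGamma (w + of_nat (Suc n)) / fact (Suc n))
        = norm x / real (Suc n) * (norm x ^ n * norm (rGamma (w + of_nat (Suc n))) / fact n)"
      by (simp add: norm_mult norm_divide norm_power del: of_nat_Suc)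
    also have "\<dots> \<le> 1/2 * (norm x ^ n * norm (rGamma (w + of_nat n)) / fact n)"
      by (intro mult_mono[OF 3] divide_right_mono mult_left_mono 2) auto
    finally show "norm (norm (x ^ Suc n * rGamma (w + of_nat (Suc n)) / fact (Suc n)))
        \<le> 1/2 * norm (norm (x ^ n * rGamma (w + of_nat n) / fact n))"
      by (simp add: norm_mult norm_divide norm_power)
  qed simp
qed

text \<open>With \<open>w = v / k\<close>, the values of \<open>k_Gamma\<close> become
  \<open>k powr (w + n) * Gamma (w + n + 1)\<close>. Then \<open>k powr w\<close> joins the
  prefactor, and \<open>k ^ n\<close> is absorbed into an everywhere convergent power series in
  \<open>x\<^sup>2\<close>.\<close>

lemma k_Bessel_J_eq:
  assumes k: "k > 0" and v: "Re (v / of_real k) > -1"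
  shows "k_Bessel_J k v x = cpow (x / 2) (v / of_real k) / of_real k powr (v / of_real k) *
    (\<Sum>n. (- (x\<^sup>2 / (4 * of_real k))) ^ n * rGamma (v / of_real k + 1 + of_nat n) / fact n)"
proof -
  define w where "w = v / of_real k"
  have w: "Re w > -1" using v by (simp add: w_def)
  define C where "C = cpow (x / 2) w / of_real k powr w"
  define d where "d = (\<lambda>n. (- (x\<^sup>2 / (4 * of_real k))) ^ n * rGamma (w + 1 + of_nat n) / fact n)"
  have "(-1) ^ n / (k_Gamma k (v + of_nat n * of_real k + of_real k) * fact n)
          * cpow (x / 2) (w + 2 * of_nat n) = C * d n" for n
  proof -
    have s: "(v + of_nat n * of_real k + of_real k) / of_real k = w + of_nat n + 1"
      using k by (simp add: w_def add_divide_distrib)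
    \<comment> \<open>\<open>Re w > -1\<close> puts every argument of \<open>k_Gamma\<close> into
      the right half-plane, where \<open>k_Gamma_eq\<close> applies.\<close>
    have "0 < Re (w + of_nat n + 1) * k" using w k by simp
    also have "\<dots> = Re (v + of_nat n * of_real k + of_real k)"
      unfolding s[symmetric] using k by simp
    finally have pos: "0 < Re (v + of_nat n * of_real k + of_real k)" .
    have "k_Gamma k (v + of_nat n * of_real k + of_real k)
        = of_real k powr (w + of_nat n) * Gamma (w + 1 + of_nat n)"
      using k_Gamma_eq[OF k pos] unfolding s by (simp add: add_ac)
    moreover have "of_real k powr (w + of_nat n) = of_real k powr w * of_real k ^ n"
      using k by (simp add: powr_add powr_nat)
    moreover have "cpow (x / 2) (w + 2 * of_nat n) = cpow (x / 2) w * (x\<^sup>2 / 4) ^ n"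
      using cpow_add_even[OF w, of "x / 2" n] by (simp add: power_mult power_divide)
    moreover have "(- (x\<^sup>2 / (4 * of_real k))) ^ n = (-1) ^ n * (x\<^sup>2 / 4) ^ n / of_real k ^ n"
      by (simp add: power_minus[of "x\<^sup>2 / _"] power_divide power_mult_distrib)
    ultimately show ?thesis
      unfolding C_def d_def rGamma_inverse_Gamma
      by (simp only: divide_inverse inverse_mult_distrib mult_ac)
  qed
  then have "k_Bessel_J k v x = (\<Sum>n. C * d n)" by (simp add: k_Bessel_J_def w_def)
  also have "\<dots> = C * (\<Sum>n. d n)"
    unfolding d_def by (rule suminf_mult[OF summable_norm_cancel[OF summable_norm_rGamma_series]])
  finally show ?thesis by (simp add: C_def d_def w_def)
qed

section \<open>Termwise integration of a dominated series\<close>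

text \<open>The integrals of the norms are at most \<open>norm (c n)\<close> times the integral of
  \<open>norm (g x)\<close>, hence summable, and this lets the Lebesgue integral pass through the
  infinite sum.\<close>

lemma has_integral_suminf_dominated:
  fixes f :: "nat \<Rightarrow> 'a::euclidean_space \<Rightarrow> complex"
  assumes f: "\<And>n. f n absolutely_integrable_on S"
    and g: "g absolutely_integrable_on S"
    and le: "\<And>n x. x \<in> S \<Longrightarrow> norm (f n x) \<le> norm (g x)"
    and c: "summable (\<lambda>n. norm (c n))"
  shows "summable (\<lambda>n. c n * integral S (f n))"
    and "((\<lambda>x. \<Sum>n. c n * f n x) has_integral (\<Sum>n. c n * integral S (f n))) S"
proof -
  \<comment> \<open>Extension by zero outside \<open>S\<close> makes the estimates valid on the
    whole space.\<close>
  define h where "h = (\<lambda>n x. indicat_real S x *\<^sub>R (c n * f n x))"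
  define G where "G = (\<lambda>x. norm (indicat_real S x *\<^sub>R g x))"
  have h: "integrable lebesgue (h n)" for n
    using set_integrable_mult_right[OF f, of "c n" n] by (simp add: h_def set_integrable_def)
  have G: "integrable lebesgue G"
    using g unfolding G_def set_integrable_def by (rule integrable_norm)
  have hG: "norm (h n x) \<le> norm (c n) * G x" for n x
    using le[of x n] by (auto simp: h_def G_def indicator_def norm_mult intro: mult_left_mono)
  have sh: "summable (\<lambda>n. norm (h n x))" for x
    by (rule summable_comparison_test'[OF summable_mult2[OF c, of "G x"], of 0])
      (use hG in simp)
  have si: "summable (\<lambda>n. \<integral>x. norm (h n x) \<partial>lebesgue)"
  proof (rule summable_comparison_test'[OF summable_mult2[OF c, of "\<integral>x. G x \<partial>lebesgue"], of 0])
    fix n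
    have "(\<integral>x. norm (h n x) \<partial>lebesgue) \<le> (\<integral>x. norm (c n) * G x \<partial>lebesgue)"
      by (intro integral_mono integrable_norm h integrable_mult_right G hG)
    then show "norm (\<integral>x. norm (h n x) \<partial>lebesgue) \<le> norm (c n) * (\<integral>x. G x \<partial>lebesgue)"
      by simp
  qed
  have int: "(\<integral>x. h n x \<partial>lebesgue) = c n * integral S (f n)" for n
  proof -
    have "(\<integral>x. h n x \<partial>lebesgue) = c n * set_lebesgue_integral lebesgue S (f n)"
      unfolding h_def set_lebesgue_integral_def
      by (simp only: mult_scaleR_right[symmetric] integral_mult_right_zero)
    also have "\<dots> = c n * integral S (f n)"
      by (simp add: set_lebesgue_integral_eq_integral(2)[OF f])
    finally show ?thesis .
  qed
  show "summable (\<lambda>n. c n * integral S (f n))"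
    using summable_integral[OF h AE_I2[OF sh] si] by (simp add: int)
  have "integrable lebesgue (\<lambda>x. \<Sum>n. h n x)"
    by (rule integrable_suminf[OF h AE_I2[OF sh] si])
  moreover have "(\<integral>x. (\<Sum>n. h n x) \<partial>lebesgue) = (\<Sum>n. c n * integral S (f n))"
    using integral_suminf[OF h AE_I2[OF sh] si] by (simp add: int)
  moreover have "(\<lambda>x. \<Sum>n. h n x) = (\<lambda>x. indicat_real S x *\<^sub>R (\<Sum>n. c n * f n x))"
    by (auto simp: h_def indicator_def)
  ultimately show "((\<lambda>x. \<Sum>n. c n * f n x) has_integral (\<Sum>n. c n * integral S (f n))) S"
    using has_integral_set_lebesgue[of S "\<lambda>x. \<Sum>n. c n * f n x"]
    by (simp add: set_integrable_def set_lebesgue_integral_def)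
qed

section \<open>Euler's Beta integral for complex parameters\<close>

text \<open>The modulus of the integrand is the real Beta integrand with parameters
  \<open>Re a\<close> and \<open>Re b\<close>, which gives absolute integrability; the value comes
  from Fubini's theorem for a product of two Gamma integrals.\<close>

lemma Beta_integral_complex:
  fixes a b :: complex
  assumes a: "Re a > 0" and b: "Re b > 0"
  defines "f \<equiv> \<lambda>t. of_real t powr (a - 1) * of_real (1 - t) powr (b - 1)"
  shows "f absolutely_integrable_on {0<..<1}" "integral {0<..<1} f = Beta a b"
proof -
  define \<gamma> where "\<gamma> = (\<lambda>z t. indicat_real {0<..} t *\<^sub>R (complex_of_real t powr (z - 1) / of_real (exp t)))"
  define \<beta> where "\<beta> = (\<lambda>t. indicat_real {0<..<1} t *\<^sub>R f t)"
  have [measurable]: "\<gamma> z \<in> borel_measurable borel" for z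
    unfolding \<gamma>_def by (auto intro!: borel_measurable_continuous_on_indicator continuous_intros)
  have [measurable]: "\<beta> \<in> borel_measurable borel"
    unfolding \<beta>_def f_def by (auto intro!: borel_measurable_continuous_on_indicator continuous_intros)
  \<comment> \<open>Borel measurability carries integrability over from the completed measure to
    \<open>lborel\<close>, on which translation, scaling and Fubini are used.\<close>
  have int_\<gamma>: "integrable lborel (\<gamma> z)" if "Re z > 0" for z
  proof -
    have "integrable lebesgue (\<gamma> z)"
      using absolutely_integrable_Gamma_integral'[OF that] by (simp add: \<gamma>_def set_integrable_def)
    then show ?thesis by (subst (asm) integrable_completion) simp_all
  qed
  have lint_\<gamma>: "(\<integral>t. \<gamma> z t \<partial>lborel) = Gamma z" if "Re z > 0" for z
  proof -
    have "set_integrable lborel {0<..} (\<lambda>t. complex_of_real t powr (z - 1) / of_real (exp t))"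
      using int_\<gamma>[OF that] by (simp add: \<gamma>_def set_integrable_def)
    from set_borel_integral_eq_integral(2)[OF this] show ?thesis
      using integral_unique[OF Gamma_integral_complex'[OF that]]
      by (simp add: \<gamma>_def set_lebesgue_integral_def)
  qed
  have norm_f: "norm (f t) = t powr (Re a - 1) * (1 - t) powr (Re b - 1)" if "t \<in> {0<..<1}" for t
    using that by (simp add: f_def norm_mult norm_powr_real_powr)
  have "integrable lborel \<beta>"
  proof (rule Bochner_Integration.integrable_bound)
    show "integrable lborel (\<lambda>t. indicat_real {0..1} t *\<^sub>R (t powr (Re a - 1) * (1 - t) powr (Re b - 1)))"
      using integrable_Beta[OF a b] by (simp add: set_integrable_def)
    show "AE t in lborel. norm (\<beta> t) \<le> norm (indicat_real {0..1} t *\<^sub>R (t powr (Re a - 1) * (1 - t) powr (Re b - 1)))"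
      by (intro AE_I2) (auto simp: \<beta>_def norm_f indicator_def)
  qed measurable
  then have sf: "set_integrable lborel {0<..<1} f" by (simp add: \<beta>_def set_integrable_def)
  then show "f absolutely_integrable_on {0<..<1}"
    by (simp add: set_integrable_def integrable_completion f_def)
  have B: "integral {0<..<1} f = (\<integral>t. \<beta> t \<partial>lborel)"
    using set_borel_integral_eq_integral(2)[OF sf] by (simp add: \<beta>_def set_lebesgue_integral_def)
  have ab: "Re (a + b) > 0" using a b by simp
  have shift: "(\<integral>u. \<gamma> b (u - t) \<partial>lborel) = Gamma b"
              "(\<integral>u. norm (\<gamma> b (u - t)) \<partial>lborel) = (\<integral>u. norm (\<gamma> b u) \<partial>lborel)"
              "integrable lborel (\<lambda>u. \<gamma> b (u - t))" for t
    using lborel_integral_real_affine[of 1 "\<gamma> b" "-t"]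
      lborel_integral_real_affine[of 1 "\<lambda>u. norm (\<gamma> b u)" "-t"]
      lborel_integrable_real_affine[OF int_\<gamma>[OF b], of 1 "-t"]
    by (simp_all add: lint_\<gamma>[OF b])
  \<comment> \<open>The convolution of the Gamma integrands for \<open>a\<close> and \<open>b\<close> is a multiple of the one for \<open>a + b\<close>;
    integrating both sides gives \<open>Gamma a * Gamma b = Gamma (a + b) * B\<close>.\<close>
  have conv: "(\<integral>t. \<gamma> a t * \<gamma> b (u - t) \<partial>lborel) = \<gamma> (a + b) u * (\<integral>t. \<beta> t \<partial>lborel)" for u
  proof (cases "u > 0")
    case True
    \<comment> \<open>Substitution \<open>t = u * x\<close>: the exponentials combine to
      \<open>exp u\<close>, and the powers of \<open>u\<close> come out of the integral.\<close>
    have "(\<integral>t. \<gamma> a t * \<gamma> b (u - t) \<partial>lborel) = u *\<^sub>R (\<integral>x. \<gamma> a (u * x) * \<gamma> b (u - u * x) \<partial>lborel)"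
      using lborel_integral_real_affine[of u "\<lambda>t. \<gamma> a t * \<gamma> b (u - t)" 0] True by simp
    also have "(\<lambda>x. \<gamma> a (u * x) * \<gamma> b (u - u * x))
        = (\<lambda>x. of_real u powr (a - 1) * of_real u powr (b - 1) / of_real (exp u) * \<beta> x)"
    proof
      fix x
      show "\<gamma> a (u * x) * \<gamma> b (u - u * x)
          = of_real u powr (a - 1) * of_real u powr (b - 1) / of_real (exp u) * \<beta> x"
      proof (cases "x \<in> {0<..<1}")
        case x: True
        have "exp (u * x) * exp (u - u * x) = exp u" by (simp add: exp_add[symmetric])
        then have e: "complex_of_real (exp (u * x)) * of_real (exp (u - u * x)) = of_real (exp u)"
          by (metis of_real_mult)
        have 1: "of_real (u * x) powr (a - 1) = of_real u powr (a - 1) * of_real x powr (a - 1)"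
          using True x by (simp add: powr_times_real)
        have 2: "of_real (u - u * x) powr (b - 1) = of_real u powr (b - 1) * of_real (1 - x) powr (b - 1)"
          using True x powr_times_real[of "of_real u" "of_real (1 - x)" "b - 1"] by (simp add: right_diff_distrib)
        have "u * x < u" using True x by simp
        then have "\<gamma> a (u * x) * \<gamma> b (u - u * x) =
           of_real (u * x) powr (a - 1) * of_real (u - u * x) powr (b - 1) /
             (of_real (exp (u * x)) * of_real (exp (u - u * x)))"
          using True x by (simp add: \<gamma>_def)
        also have "\<dots> = of_real u powr (a - 1) * of_real u powr (b - 1) / of_real (exp u) * f x"
          unfolding e 1 2 by (simp add: f_def)
        finally show ?thesis using x by (simp add: \<beta>_def)
      next
        case x: False
        then have "u * x \<le> 0 \<or> u - u * x \<le> 0"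
          using True by (auto simp: mult_le_0_iff)
        then show ?thesis using x by (auto simp: \<gamma>_def \<beta>_def)
      qed
    qed
    also have "u *\<^sub>R (\<integral>x. of_real u powr (a - 1) * of_real u powr (b - 1) / of_real (exp u) * \<beta> x \<partial>lborel)
        = \<gamma> (a + b) u * (\<integral>t. \<beta> t \<partial>lborel)"
    proof -
      have "a + b - 1 = (a - 1) + (b - 1) + 1" by simp
      then have "of_real u powr (a + b - 1) = of_real u powr (a - 1) * of_real u powr (b - 1) * complex_of_real u"
        using True by (simp only: powr_add) simp
      then show ?thesis using True by (simp add: \<gamma>_def scaleR_conv_of_real)
    qed
    finally show ?thesis .
  next
    case False
    then have "\<gamma> a t * \<gamma> b (u - t) = 0" for t by (auto simp: \<gamma>_def indicator_def)
    then have "(\<integral>t. \<gamma> a t * \<gamma> b (u - t) \<partial>lborel) = 0"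
      by (simp only: Bochner_Integration.integral_zero)
    then show ?thesis using False by (simp add: \<gamma>_def)
  qed
  \<comment> \<open>By translation invariance, the inner integral of the norms is a constant
    multiple of \<open>norm (\<gamma> a t)\<close>.\<close>
  have int2: "integrable (lborel \<Otimes>\<^sub>M lborel) (\<lambda>(t, u). \<gamma> a t * \<gamma> b (u - t))"
  proof (rule lborel_pair.Fubini_integrable)
    show "integrable lborel (\<lambda>t. \<integral>u. norm (case (t, u) of (t, u) \<Rightarrow> \<gamma> a t * \<gamma> b (u - t)) \<partial>lborel)"
      using int_\<gamma>[OF a] by (simp add: norm_mult shift)
    show "AE t in lborel. integrable lborel (\<lambda>u. case (t, u) of (t, u) \<Rightarrow> \<gamma> a t * \<gamma> b (u - t))"
      by (simp add: shift)
  qed measurable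
  have "Gamma a * Gamma b = (\<integral>t. (\<integral>u. \<gamma> a t * \<gamma> b (u - t) \<partial>lborel) \<partial>lborel)"
    by (simp add: shift lint_\<gamma>[OF a])
  also have "\<dots> = (\<integral>u. (\<integral>t. \<gamma> a t * \<gamma> b (u - t) \<partial>lborel) \<partial>lborel)"
    using lborel_pair.Fubini_integral[OF int2] by simp
  also have "\<dots> = Gamma (a + b) * (\<integral>t. \<beta> t \<partial>lborel)"
    by (simp add: conv lint_\<gamma>[OF ab])
  finally have "Gamma a * Gamma b = Gamma (a + b) * (\<integral>t. \<beta> t \<partial>lborel)" .
  \<comment> \<open>\<open>Gamma\<close> takes the default value 0 at its poles, the nonpositive
    integers, which \<open>Re (a + b) > 0\<close> excludes.\<close>
  moreover have "Gamma (a + b) \<noteq> 0"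
    using ab by (auto simp: Gamma_eq_zero_iff simp del: plus_complex.sel elim!: nonpos_Ints_cases)
  ultimately show "integral {0<..<1} f = Beta a b"
    unfolding B Beta_def by (simp add: field_simps)
qed

section \<open>The Lavoie-Trottier integral\<close>

text \<open>Under the cubic substitution into the Beta integral, the Jacobian supplies one factor
  \<open>1 - x\<close> and one factor \<open>1 - x / 3\<close>, completing the exponents
  \<open>2 * b - 1\<close> and \<open>2 * a - 1\<close>. The constants collect to
  \<open>(9/4) powr a\<close>, whose inverse is \<open>(2/3) powr (2 * a)\<close>.\<close>

lemma Lavoie_Trottier_integral:
  fixes a b :: complex
  assumes a: "Re a > 0" and b: "Re b > 0"
  defines "F \<equiv> \<lambda>x. of_real x powr (a - 1) * of_real (1 - x) powr (2 * b - 1)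
      * of_real (1 - x / 3) powr (2 * a - 1) * of_real (1 - x / 4) powr (b - 1)"
  shows "F absolutely_integrable_on {0<..<1}" "integral {0<..<1} F = (2 / 3) powr (2 * a) * Beta a b"
proof -
  define f :: "real \<Rightarrow> complex" where "f = (\<lambda>t. of_real t powr (a - 1) * of_real (1 - t) powr (b - 1))"
  define g :: "real \<Rightarrow> real" where "g = (\<lambda>x. 9/4 * x * (1 - x / 3)\<^sup>2)"
  define g' :: "real \<Rightarrow> real" where "g' = (\<lambda>x. 9/4 * (1 - x) * (1 - x / 3))"
  \<comment> \<open>The factor \<open>9/4\<close> normalises \<open>g 1 = 1\<close>. As
    \<open>g' 1 = 0\<close>, the cubic \<open>1 - g x\<close> has a double zero at 1; its remaining
    zero is 4.\<close>
  have g1: "1 - g x = (1 - x)\<^sup>2 * (1 - x / 4)" for x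
    by (simp add: g_def power2_eq_square algebra_simps)
  have der: "(g has_field_derivative g' x) (at x within A)" for x A
    unfolding g_def g'_def by (auto intro!: derivative_eq_intros simp: power2_eq_square algebra_simps)
  \<comment> \<open>Since \<open>g' 1 = 0\<close>, positivity of the derivative is required in the
    open interval only; monotonicity up to the endpoints then locates the image.\<close>
  have mono: "g x < g y" if "x \<in> {0..1}" "y \<in> {0..1}" "x < y" for x y
  proof (rule DERIV_pos_imp_increasing_open[OF \<open>x < y\<close>])
    fix z assume "x < z" "z < y"
    then have "g' z > 0" using that by (simp add: g'_def)
    then show "\<exists>d. (g has_real_derivative d) (at z) \<and> 0 < d" using der by blast
  qed (auto simp: g_def intro!: continuous_intros)
  have inj: "inj_on g {0<..<1}"
    by (rule linorder_inj_onI') (use mono in \<open>force simp: less_imp_neq\<close>)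
  have img: "g ` {0<..<1} = {0<..<1}"
  proof (intro equalityI subsetI)
    fix u assume "u \<in> g ` {0<..<1}"
    then obtain x where "0 < x" "x < 1" "u = g x" by auto
    then have "g 0 < u" "u < g 1" using mono[of 0 x] mono[of x 1] by auto
    then show "u \<in> {0<..<1}" by (simp add: g_def power2_eq_square)
  next
    fix u :: real assume u: "u \<in> {0<..<1}"
    have "\<exists>x. 0 \<le> x \<and> x \<le> 1 \<and> g x = u"
      using u by (intro IVT') (auto simp: g_def power2_eq_square intro!: continuous_intros)
    then obtain x where x: "0 \<le> x" "x \<le> 1" "g x = u" by blast
    moreover have "x \<noteq> 0" "x \<noteq> 1" using x u by (auto simp: g_def power2_eq_square)
    ultimately show "u \<in> g ` {0<..<1}" by force
  qed
  have "f absolutely_integrable_on g ` {0<..<1} \<and> integral (g ` {0<..<1}) f = Beta a b"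
    unfolding img f_def using Beta_integral_complex[OF a b] by blast
  then have I: "(\<lambda>x. \<bar>g' x\<bar> *\<^sub>R f (g x)) absolutely_integrable_on {0<..<1}"
      "integral {0<..<1} (\<lambda>x. \<bar>g' x\<bar> *\<^sub>R f (g x)) = Beta a b"
    using has_absolute_integral_change_of_variables_real[OF _ der inj, of f "Beta a b"] by simp_all
  have eq: "F x = (2 / 3) powr (2 * a) * (\<bar>g' x\<bar> *\<^sub>R f (g x))" if "x \<in> {0<..<1}" for x
  proof -
    have x: "0 < x" "x < 1" using that by auto
    have powr_exp: "complex_of_real r powr s = exp (s * of_real (ln r))" if "r > 0" for r s
      using that by (simp add: powr_def Ln_of_real)
    define X where "X = complex_of_real (ln x)"
    define Y where "Y = complex_of_real (ln (1 - x))"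
    define U where "U = complex_of_real (ln (1 - x / 3))"
    define V where "V = complex_of_real (ln (1 - x / 4))"
    define T where "T = complex_of_real (ln (2 / 3))"
    \<comment> \<open>Writing \<open>9/4\<close> through \<open>2/3\<close> makes all terms in
      \<open>T\<close> cancel when the exponents are added up.\<close>
    have c: "ln (9 / 4 :: real) = - 2 * ln (2 / 3)"
      using ln_realpow[of "3 / 2 :: real" 2] ln_inverse[of "2 / 3 :: real"] by (simp add: power2_eq_square)
    have ln_prod: "ln (p * q * s\<^sup>2) = ln p + ln q + 2 * ln s" if "p > 0" "q > 0" "s > 0" for p q s :: real
      using that by (simp add: ln_mult ln_realpow)
    have "ln (g x) = ln (9 / 4) + ln x + 2 * ln (1 - x / 3)"
      unfolding g_def using x by (intro ln_prod) auto
    then have lg: "of_real (ln (g x)) = - 2 * T + X + 2 * U" unfolding c by (simp add: T_def X_def U_def)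
    have "ln (1 - g x) = 2 * ln (1 - x) + ln (1 - x / 4)"
      using ln_prod[of 1 "1 - x / 4" "1 - x"] x by (simp add: g1 mult_ac)
    then have lg1: "of_real (ln (1 - g x)) = 2 * Y + V" by (simp add: Y_def V_def)
    have "g' x > 0" using x by (simp add: g'_def)
    moreover have "ln (g' x) = ln (9 / 4) + ln (1 - x) + ln (1 - x / 3)"
      unfolding g'_def using x by (subst ln_mult; simp add: ln_mult del: times_divide_eq_left)
    ultimately have "complex_of_real \<bar>g' x\<bar> = exp (of_real (ln (9 / 4) + ln (1 - x) + ln (1 - x / 3)))"
      by (metis abs_of_pos exp_ln exp_of_real)
    then have lg': "complex_of_real \<bar>g' x\<bar> = exp (- 2 * T + Y + U)"
      unfolding c by (simp add: T_def Y_def U_def)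
    have gx: "g x > 0" "1 - g x > 0" using img that by auto
    have "(2 / 3 :: complex) powr (2 * a) = exp (2 * a * T)"
      using powr_exp[of "2 / 3"] by (simp add: T_def)
    then have "(2 / 3) powr (2 * a) * (\<bar>g' x\<bar> *\<^sub>R f (g x))
        = exp (2 * a * T) * exp (- 2 * T + Y + U) * exp ((a - 1) * (- 2 * T + X + 2 * U))
            * exp ((b - 1) * (2 * Y + V))"
      unfolding scaleR_conv_of_real f_def powr_exp[OF gx(1)] powr_exp[OF gx(2)] lg lg1 lg' by simp
    also have "\<dots> = exp ((a - 1) * X) * exp ((2 * b - 1) * Y) * exp ((2 * a - 1) * U) * exp ((b - 1) * V)"
      unfolding exp_add[symmetric] by (simp add: algebra_simps)
    also have "\<dots> = F x"
      unfolding F_def X_def Y_def U_def V_def using x by (simp add: powr_exp del: of_real_diff)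
    finally show ?thesis ..
  qed
  have "(\<lambda>x. (2 / 3) powr (2 * a) * (\<bar>g' x\<bar> *\<^sub>R f (g x))) absolutely_integrable_on {0<..<1}"
    by (rule set_integrable_mult_right[OF I(1)])
  then show "F absolutely_integrable_on {0<..<1}"
    by (rule set_integrable_cong[THEN iffD1, rotated -1]) (auto simp: eq)
  have "integral {0<..<1} F = integral {0<..<1} (\<lambda>x. (2 / 3) powr (2 * a) * (\<bar>g' x\<bar> *\<^sub>R f (g x)))"
    by (rule integral_cong) (rule eq)
  then show "integral {0<..<1} F = (2 / 3) powr (2 * a) * Beta a b"
    by (simp only: integral_mult_right I)
qed

section \<open>Assembly of the k-Bessel integral\<close>

theorem corollary3p3:
  fixes k :: real and lam rho v y :: complex
  assumes "k > 0"
    and "Re (v / of_real k) > -1"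
    and "Re (lam + rho) > 0"
    and "Re (lam + v / of_real k) > 0"
  shows "((\<lambda>z::real.
            of_real z powr (lam - 1)
            * of_real (1 - z) powr (2 * (lam + rho) - 1)
            * of_real (1 - z / 3) powr (2 * lam - 1)
            * of_real (1 - z / 4) powr ((lam + rho) - 1)
            * k_Bessel_J k v (y * of_real (z * (1 - z / 3)\<^sup>2)))
          has_integral
            (cpow (y / 2) (v / of_real k) * Gamma (lam + rho)
               * (2 / 3) powr (2 * (lam + v / of_real k))
             / of_real k powr (v / of_real k)
             * Wright_Psi_1_2 (lam + v / of_real k, 2)
                 (v / of_real k + 1, 1) (2 * lam + v / of_real k + rho, 2)
                 (- (4 * y\<^sup>2 / (81 * of_real k))))) {0<..<1}"
proof -
  define w where "w = v / of_real k"
  define a where "a = lam + w"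
  define b where "b = lam + rho"
  have k: "k > 0" and w: "Re w > -1" and a: "Re a > 0" and b: "Re b > 0"
    using assms by (simp_all add: w_def a_def b_def)
  \<comment> \<open>For \<open>x\<close> in the open unit interval, the Bessel function at
    \<open>y * r x\<close> is \<open>C * r x powr w\<close> times the sum of
    \<open>d n * r x ^ (2 * n)\<close>.\<close>
  define C where "C = cpow (y / 2) w / of_real k powr w"
  define d where "d = (\<lambda>n. (- (y\<^sup>2 / (4 * of_real k))) ^ n * rGamma (w + 1 + of_nat n) / fact n)"
  \<comment> \<open>The Lavoie-Trottier integrand with parameters \<open>a + 2 * n\<close> and
    \<open>b\<close>; on the open unit interval it equals the weight of the theorem times
    \<open>r x powr (w + 2 * n)\<close>.\<close>
  define F where "F = (\<lambda>n x. of_real x powr (a + 2 * of_nat n - 1) * of_real (1 - x) powr (2 * b - 1)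
      * of_real (1 - x / 3) powr (2 * (a + 2 * of_nat n) - 1) * of_real (1 - x / 4) powr (b - 1))"
  define r :: "real \<Rightarrow> real" where "r = (\<lambda>x. x * (1 - x / 3)\<^sup>2)"
  have an: "Re (a + 2 * of_nat n) > 0" for n using a by simp
  have F_int: "F n absolutely_integrable_on {0<..<1}"
      "integral {0<..<1} (F n) = (2 / 3) powr (2 * (a + 2 * of_nat n)) * Beta (a + 2 * of_nat n) b" for n
    unfolding F_def by (fact Lavoie_Trottier_integral[OF an b])+
  have r: "0 < r x" "r x \<le> 1" if "x \<in> {0<..<1}" for x
    using that by (auto simp: r_def intro!: mult_le_one power_le_one)
  have r_powr: "of_real (r x) powr s = of_real x powr s * of_real (1 - x / 3) powr (2 * s)"
    if "x \<in> {0<..<1}" for x and s :: complex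
  proof -
    have "ln (r x) = ln x + 2 * ln (1 - x / 3)"
      unfolding r_def using that by (simp add: ln_mult ln_realpow)
    moreover have "complex_of_real u powr q = exp (q * of_real (ln u))" if "u > 0" for u q
      using that by (simp add: powr_def Ln_of_real)
    ultimately show ?thesis
      using that r(1)[OF that] by (simp add: exp_add[symmetric] algebra_simps del: of_real_diff)
  qed
  have F_eq: "F n x = of_real x powr (lam - 1) * of_real (1 - x) powr (2 * (lam + rho) - 1)
      * of_real (1 - x / 3) powr (2 * lam - 1) * of_real (1 - x / 4) powr ((lam + rho) - 1)
      * of_real (r x) powr w * of_real (r x) ^ (2 * n)" if x: "x \<in> {0<..<1}" for n x
  proof -
    define q where "q = w + 2 * of_nat n"
    have e: "a + 2 * of_nat n - 1 = (lam - 1) + q" "2 * (a + 2 * of_nat n) - 1 = (2 * lam - 1) + 2 * q"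
      by (simp_all add: a_def q_def algebra_simps)
    have "of_real (r x) powr w * of_real (r x) ^ (2 * n) = of_real (r x) powr q"
      using r(1)[OF x] powr_nat[of "of_real (r x)" "2 * n"] by (simp add: q_def powr_add)
    also have "\<dots> = of_real x powr q * of_real (1 - x / 3) powr (2 * q)"
      by (rule r_powr[OF x])
    finally have "of_real (r x) powr w * of_real (r x) ^ (2 * n) = \<dots>" .
    then show ?thesis
      unfolding F_def e b_def powr_add mult.assoc by simp
  qed
  \<comment> \<open>\<open>F n x\<close> is \<open>F 0 x\<close> times \<open>r x ^ (2 * n)\<close>
    with \<open>0 < r x \<le> 1\<close>, so \<open>F 0\<close> dominates all terms.\<close>
  have F_le: "norm (F n x) \<le> norm (F 0 x)" if "x \<in> {0<..<1}" for n x
  proof -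
    have "F n x = F 0 x * of_real (r x) ^ (2 * n)" using that by (simp add: F_eq)
    then have "norm (F n x) = norm (F 0 x) * r x ^ (2 * n)"
      using r(1)[OF that] by (simp add: norm_mult norm_power)
    also have "\<dots> \<le> norm (F 0 x) * 1"
      using r[OF that] by (intro mult_left_mono power_le_one) auto
    finally show ?thesis by simp
  qed
  have d: "summable (\<lambda>n. norm (d n))"
    unfolding d_def by (rule summable_norm_rGamma_series)
  note I = has_integral_suminf_dominated[where f = F, OF F_int(1) F_int(1)[of 0] F_le d]
  define \<Psi> where "\<Psi> = (\<lambda>n. Gamma (a + 2 * of_nat n) / (Gamma (w + 1 + of_nat n) * Gamma (a + b + 2 * of_nat n))
      * ((- (4 * y\<^sup>2 / (81 * of_real k))) ^ n / fact n))"
  define K where "K = (2 / 3) powr (2 * a) * Gamma b"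
  \<comment> \<open>A nonzero \<open>K\<close> lets summability pass from
    \<open>K * \<Psi> n\<close> to \<open>\<Psi> n\<close>, so that \<open>K\<close> can be pulled
    out of the series.\<close>
  have K: "K \<noteq> 0"
    using b by (auto simp: K_def Gamma_eq_zero_iff elim!: nonpos_Ints_cases)
  have summand: "d n * integral {0<..<1} (F n) = K * \<Psi> n" for n
  proof -
    \<comment> \<open>The parameter shift by \<open>2 * n\<close> contributes
      \<open>(2/3) ^ (4 * n) = (16/81) ^ n\<close>, which turns \<open>y\<^sup>2 / (4 * k)\<close>
      into \<open>4 * y\<^sup>2 / (81 * k)\<close>.\<close>
    have "(2 / 3 :: complex) powr (4 * of_nat n) = (2 / 3) ^ (4 * n)"
      using powr_nat[of "2 / 3 :: complex" "4 * n"] by simp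
    then have 1: "(2 / 3 :: complex) powr (2 * (a + 2 * of_nat n)) = (2 / 3) powr (2 * a) * (16 / 81) ^ n"
      by (simp add: distrib_left powr_add power_mult power_divide)
    have "- (y\<^sup>2 / (4 * of_real k)) * (16 / 81) = - (4 * y\<^sup>2 / (81 * of_real k))"
      by simp
    then have 2: "(- (4 * y\<^sup>2 / (81 * of_real k))) ^ n = (- (y\<^sup>2 / (4 * of_real k))) ^ n * (16 / 81) ^ n"
      by (simp only: power_mult_distrib[symmetric])
    have 3: "a + b + 2 * of_nat n = a + 2 * of_nat n + b" by simp
    show ?thesis
      unfolding d_def F_int(2) \<Psi>_def K_def 1 2 3 Beta_def rGamma_inverse_Gamma
      by (simp only: divide_inverse inverse_mult_distrib mult_ac)
  qed
  have "summable \<Psi>"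
    using I(1) K unfolding summand by (simp add: summable_cmult_iff)
  then have "(\<Sum>n. d n * integral {0<..<1} (F n)) = K * (\<Sum>n. \<Psi> n)"
    unfolding summand by (rule suminf_mult)
  with I(2) have "((\<lambda>x. \<Sum>n. d n * F n x) has_integral K * (\<Sum>n. \<Psi> n)) {0<..<1}"
    by simp
  then have *: "((\<lambda>x. C * (\<Sum>n. d n * F n x)) has_integral C * (K * (\<Sum>n. \<Psi> n))) {0<..<1}"
    by (rule has_integral_mult_right)
  have ab: "a + b = 2 * lam + w + rho" by (simp add: a_def b_def)
  have wright: "Wright_Psi_1_2 (lam + w, 2) (w + 1, 1) (2 * lam + w + rho, 2) (- (4 * y\<^sup>2 / (81 * of_real k)))
      = (\<Sum>n. \<Psi> n)"
    unfolding Wright_Psi_1_2_def \<Psi>_def ab[symmetric] a_def[symmetric]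
    by (simp only: prod.case of_real_1 mult_1 of_real_numeral)
  have const: "C * (K * (\<Sum>n. \<Psi> n)) = cpow (y / 2) (v / of_real k) * Gamma (lam + rho)
               * (2 / 3) powr (2 * (lam + v / of_real k))
             / of_real k powr (v / of_real k)
             * Wright_Psi_1_2 (lam + v / of_real k, 2)
                 (v / of_real k + 1, 1) (2 * lam + v / of_real k + rho, 2)
                 (- (4 * y\<^sup>2 / (81 * of_real k)))"
    unfolding w_def[symmetric] wright by (simp add: C_def K_def a_def b_def)
  have integrand: "C * (\<Sum>n. d n * F n x) =
      of_real x powr (lam - 1) * of_real (1 - x) powr (2 * (lam + rho) - 1)
      * of_real (1 - x / 3) powr (2 * lam - 1) * of_real (1 - x / 4) powr ((lam + rho) - 1)
      * k_Bessel_J k v (y * of_real (x * (1 - x / 3)\<^sup>2))" if x: "x \<in> {0<..<1}" for x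
  proof -
    define P where "P = of_real x powr (lam - 1) * of_real (1 - x) powr (2 * (lam + rho) - 1)
      * of_real (1 - x / 3) powr (2 * lam - 1) * complex_of_real (1 - x / 4) powr ((lam + rho) - 1)"
    define S where "S = (\<lambda>n. (- ((y * of_real (r x))\<^sup>2 / (4 * of_real k))) ^ n
        * rGamma (w + 1 + of_nat n) / fact n)"
    have "summable S"
      unfolding S_def by (rule summable_norm_cancel[OF summable_norm_rGamma_series])
    have "S n = d n * of_real (r x) ^ (2 * n)" for n
    proof -
      have "- ((y * of_real (r x))\<^sup>2 / (4 * of_real k)) = - (y\<^sup>2 / (4 * of_real k)) * (of_real (r x))\<^sup>2"
        by (simp add: power_mult_distrib)
      then show ?thesis
        unfolding S_def d_def by (simp only: power_mult_distrib power_mult) simp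
    qed
    then have "d n * F n x = P * of_real (r x) powr w * S n" for n
      by (simp add: F_eq[OF x] P_def mult_ac)
    then have "C * (\<Sum>n. d n * F n x) = C * (P * of_real (r x) powr w * (\<Sum>n. S n))"
      using \<open>summable S\<close> by (simp add: suminf_mult)
    \<comment> \<open>Positivity of \<open>r x\<close> permits merging its power with that of the
      complex number \<open>y / 2\<close>.\<close>
    also have "\<dots> = P * (cpow (y / 2 * of_real (r x)) w / of_real k powr w * (\<Sum>n. S n))"
      unfolding cpow_mult_of_real[OF r(1)[OF x]] C_def by simp
    also have "\<dots> = P * k_Bessel_J k v (y * of_real (r x))"
      unfolding k_Bessel_J_eq[OF assms(1,2)] S_def w_def by simp
    finally show ?thesis by (simp add: P_def r_def)
  qed
  show ?thesis
    using has_integral_cong[THEN iffD1, OF integrand *] unfolding const .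
qed

end
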